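(* Let $d \ge 1$, let $W \in \mathbb{R}^{d\times d}$ have spectral radius $\rho(W) < 1$, and let $W_{\mathrm{in}} \in \mathbb{R}^{d\times 2}$, $\mathbf{b} \in \mathbb{R}^d$, $w_{\mathrm{out}} \in \mathbb{R}^{1\times d}$, $b_{\mathrm{out}} \in \mathbb{R}$. Then for every $a_{\mathrm{opp}}^{*} \in [0,1]$, the equation $$\mathbf{x}^{*} = \tanh\Bigl(W \mathbf{x}^{*} + W_{\mathrm{in}}\,\bigl[\sigma(w_{\mathrm{out}}\mathbf{x}^{*} + b_{\mathrm{out}}),\; a_{\mathrm{opp}}^{*}\bigr]^{\top} + \mathbf{b}\Bigr)$$ has at least one solution $\mathbf{x}^{*} \in [-1,1]^d$.
   Context: Here $\sigma(z) = 1/(1+e^{-z})$ is the logistic sigmoid and $\tanh$ is applied componentwise to vectors. The equation is the fixed-point (self-consistency) equation of the noise-free echo state network $\mathbf{x}(t+1) = \tanh(W\mathbf{x}(t) + W_{\mathrm{in}}[a(t), a_{\mathrm{opp}}(t)]^{\top} + \mathbf{b})$ when the agent's own action is fed back as $a(t) = \sigma(w_{\mathrm{out}}\mathbf{x}(t) + b_{\mathrm{out}})$ and the opponent plays the constant action $a_{\mathrm{opp}}(t) \equiv a_{\mathrm{opp}}^{*}$. *)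

theory Defs
  imports "HOL-Analysis.Analysis"
begin

definition logistic :: "real \<Rightarrow> real" where
  "logistic z = 1 / (1 + exp (- z))"

definition tanh_vec :: "real ^ 'n \<Rightarrow> real ^ 'n" where
  "tanh_vec v = (\<chi> i. tanh (v $ i))"

definition complex_eigenvalues :: "real ^ 'n ^ 'n \<Rightarrow> complex set" where
  "complex_eigenvalues A =
    {\<mu>. \<exists>v :: complex ^ 'n. v \<noteq> 0 \<and> (\<chi> i j. complex_of_real (A $ i $ j)) *v v = \<mu> *s v}"

(* A real matrix may have no real eigenvalue, hence the maximum is over the complex ones;
   there are finitely many and at least one, so the maximum is attained. *)
definition spectral_radius :: "real ^ 'n ^ 'n \<Rightarrow> real" where
  "spectral_radius A = Max (cmod ` complex_eigenvalues A)"

end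

theory Submission
  imports Defs
begin

text \<open>The right-hand side of the equation is a continuous function of the state, and since
  \<open>tanh\<close> takes values in (-1, 1), it sends the cube [-1,1]^d into itself. The cube is
  compact, convex and nonempty, so Brouwer's theorem yields a fixed point there.
  \<open>tanh_vec_fixpoint\<close> carries this out for any continuous argument of
  \<open>tanh_vec\<close>; the rest is continuity of the feedback map.\<close>

lemma continuous_on_logistic [continuous_intros]:
  assumes "continuous_on S f"
  shows "continuous_on S (\<lambda>x. logistic (f x))"
proof -
  have "1 + exp (- z) \<noteq> 0" for z :: real
    using exp_gt_zero[of "- z"] by linarith
  then show ?thesis
    unfolding logistic_def by (intro continuous_intros assms ballI)
qed

lemma continuous_on_tanh_vec [continuous_intros]:
  fixes f :: "'a::topological_space \<Rightarrow> real ^ 'n"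
  assumes "continuous_on S f"
  shows "continuous_on S (\<lambda>x. tanh_vec (f x))"
  unfolding tanh_vec_def
  \<comment> \<open>The side condition left to \<open>auto\<close> is that \<open>cosh\<close>, the
    denominator of \<open>tanh\<close>, has no real zero.\<close>
  by (intro continuous_on_vec_lambda continuous_on_tanh continuous_on_component assms) auto

lemma continuous_on_vector_2 [continuous_intros]:
  fixes f g :: "'a::topological_space \<Rightarrow> real"
  assumes "continuous_on S f" "continuous_on S g"
  shows "continuous_on S (\<lambda>x. vector [f x, g x] :: real ^ 2)"
proof -
  \<comment> \<open>Recasting the list-based \<open>vector\<close> as a \<chi>-abstraction lets
    continuity be checked one component at a time.\<close>
  have "(\<lambda>x. vector [f x, g x] :: real ^ 2) = (\<lambda>x. \<chi> i. if i = 1 then f x else g x)"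
    by (auto simp: fun_eq_iff vec_eq_iff forall_2)
  moreover have "continuous_on S (\<lambda>x. if i = 1 then f x else g x)" for i :: 2
    using assms by (cases "i = 1") auto
  ultimately show ?thesis
    by (simp only: continuous_on_vec_lambda)
qed

text \<open>Here \<open>- 1\<close> and \<open>1\<close> are constant vectors, so the box is the
  cube [-1,1]^n. As \<open>v\<close> is arbitrary, any map followed by \<open>tanh_vec\<close> lands
  in it.\<close>

lemma tanh_vec_in_cube: "tanh_vec v \<in> cbox (- 1) 1"
proof -
  have "tanh x \<in> {-1..1}" for x :: real
    using tanh_real_bounds[of x] by auto
  then show ?thesis
    by (auto simp: mem_box_cart tanh_vec_def)
qed

text \<open>Brouwer applies to \<open>tanh_vec\<close> composed with \<open>g\<close> because the
  outer \<open>tanh_vec\<close> alone forces the self-map property; of \<open>g\<close> only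
  continuity is asked, not a bound.\<close>

lemma tanh_vec_fixpoint:
  fixes g :: "real ^ 'n \<Rightarrow> real ^ 'n"
  assumes "continuous_on (cbox (- 1) 1) g"
  obtains x where "x \<in> cbox (- 1) 1" "x = tanh_vec (g x)"
proof -
  have "cbox (- 1) 1 \<noteq> ({} :: (real ^ 'n) set)"
    using tanh_vec_in_cube by auto
  moreover have "continuous_on (cbox (- 1) 1) (\<lambda>x. tanh_vec (g x))"
    by (intro continuous_intros assms)
  moreover have "(\<lambda>x. tanh_vec (g x)) \<in> cbox (- 1) 1 \<rightarrow> cbox (- 1) 1"
    by (simp add: tanh_vec_in_cube)
  ultimately obtain x where "x \<in> cbox (- 1) 1" "tanh_vec (g x) = x"
    by (rule brouwer[OF compact_cbox convex_box(1)])
  then show ?thesis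
    by (rule that[OF _ sym])
qed

theorem theorem3p2:
  fixes W :: "real ^ 'd ^ 'd"
    and W_in :: "real ^ 2 ^ 'd"
    and b :: "real ^ 'd"
    and w_out :: "real ^ 'd ^ 1"
    and b_out :: real
  assumes "spectral_radius W < 1"
  shows "\<forall>a_opp \<in> {0..1 :: real}. \<exists>x :: real ^ 'd.
    (\<forall>i. x $ i \<in> {-1..1}) \<and>
    x = tanh_vec (W *v x + W_in *v vector [logistic ((w_out *v x) $ 1 + b_out), a_opp] + b)"
proof
  fix a_opp :: real
  let ?g = "\<lambda>x. W *v x + W_in *v vector [logistic ((w_out *v x) $ 1 + b_out), a_opp] + b"
  \<comment> \<open>Stated for all matrix shapes, since \<open>W\<close>, \<open>W_in\<close> and
    \<open>w_out\<close> have different dimensions.\<close>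
  have mult: "continuous_on S (\<lambda>x. A *v f x)"
    if "continuous_on S f"
    for A :: "real ^ 'm ^ 'n" and f :: "real ^ 'd \<Rightarrow> real ^ 'm" and S
    using linear_continuous_on_compose[OF that matrix_vector_mul_linear] .
  have "continuous_on (cbox (- 1) 1) ?g"
    by (intro continuous_intros mult)
  then obtain x where x: "x \<in> cbox (- 1) 1" "x = tanh_vec (?g x)"
    by (rule tanh_vec_fixpoint)
  from x(1) have "\<forall>i. x $ i \<in> {-1..1}"
    by (simp add: mem_box_cart)
  with x(2) show "\<exists>x. (\<forall>i. x $ i \<in> {-1..1}) \<and> x = tanh_vec (?g x)"
    by blast
qed

end
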